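(* For all non-negative integers $n,m,p,q$ and all complex $z,w,\gamma$, the partial derivatives of $H_{n,m}^{(p,q)}(z,w|\gamma)$ are given by $$\partial_{z}H_{n,m}^{(p,q)}(z,w|\gamma)=n\,H_{n-1,m}^{(p,q)}(z,w|\gamma),$$ $$\partial_{w}H_{n,m}^{(p,q)}(z,w|\gamma)=m\,H_{n,m-1}^{(p,q)}(z,w|\gamma),$$ $$\partial_{\gamma}H_{n,m}^{(p,q)}(z,w|\gamma)=\partial_{z}^{p}\partial_{w}^{q}H_{n,m}^{(p,q)}(z,w|\gamma).$$
   Context: For non-negative integers $n,m,p,q$ and complex $z,w,\gamma$, $$H_{n,m}^{(p,q)}(z,w|\gamma)= n!\,m!\sum_{k=0}^{\lfloor n/p\rfloor\wedge\lfloor m/q\rfloor}\frac{\gamma^k}{k!}\frac{z^{n-pk}}{(n-pk)!}\frac{w^{m-qk}}{(m-qk)!},$$ where $a\wedge b=\min\{a,b\}$ and $\lfloor j/0\rfloor=+\infty$ by convention (so for $p=q=0$ the sum is the infinite series $e^{\gamma}z^nw^m$); $0^0=1$. The right-hand side $nH_{n-1,m}^{(p,q)}$ is read as $0$ when $n=0$, and $mH_{n,m-1}^{(p,q)}$ is read as $0$ when $m=0$. *)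

theory Defs
  imports "HOL-Analysis.Analysis"
begin

text \<open>The floor of \<open>j / d\<close>, with the convention that it is infinite for \<open>d = 0\<close>
  (including \<open>j = 0\<close>).\<close>

definition efloor_div :: "nat \<Rightarrow> nat \<Rightarrow> enat" where
  "efloor_div j d = (if d = 0 then \<infinity> else enat (j div d))"

text \<open>The index set is finite unless \<open>p = q = 0\<close>, so the infinite sum is an ordinary finite sum
  except in that case, where it is the (absolutely convergent) exponential series. The truncated
  subtractions are exact on the index set.\<close>

definition gen_hermite :: "nat \<Rightarrow> nat \<Rightarrow> nat \<Rightarrow> nat \<Rightarrow> complex \<Rightarrow> complex \<Rightarrow> complex \<Rightarrow> complex" where
  "gen_hermite p q n m z w \<gamma> =
     fact n * fact m *
     (\<Sum>\<^sub>\<infinity>k\<in>{k. enat k \<le> min (efloor_div n p) (efloor_div m q)}.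
        \<gamma> ^ k / fact k
        * (z ^ (n - p * k) / fact (n - p * k))
        * (w ^ (m - q * k) / fact (m - q * k)))"

end

theory Submission
  imports Defs
begin

text \<open>Let \<open>E\<^sub>n\<^sub>,\<^sub>j\<close> denote the \<open>j\<close>-th derivative of \<open>x\<^sup>n\<close>. Then
  \<open>H = (\<Sum>k. \<gamma>\<^sup>k / k! * E\<^sub>n\<^sub>,\<^sub>p\<^sub>k(z) * E\<^sub>m\<^sub>,\<^sub>q\<^sub>k(w))\<close>, where terms outside the index set
  vanish. Applying \<open>\<partial>\<^sub>z\<^sup>p \<partial>\<^sub>w\<^sup>q\<close> raises the second indices to \<open>p(k+1)\<close> and \<open>q(k+1)\<close>,
  which is what \<open>\<partial>\<^sub>\<gamma>\<close> does after shifting \<open>k\<close>; and \<open>E\<^sub>n\<^sub>,\<^sub>j\<^sub>+\<^sub>1 = n E\<^sub>n\<^sub>-\<^sub>1\<^sub>,\<^sub>j\<close>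
  gives the lowering relations.\<close>

definition power_deriv :: "nat \<Rightarrow> nat \<Rightarrow> 'a \<Rightarrow> 'a::real_normed_field" where
  "power_deriv n j x = (if j \<le> n then fact n / fact (n - j) * x ^ (n - j) else 0)"

lemma power_deriv_0 [simp]: "power_deriv n 0 x = x ^ n"
  by (simp add: power_deriv_def)

lemma power_deriv_eq_0: "n < j \<Longrightarrow> power_deriv n j x = 0"
  by (simp add: power_deriv_def)

lemma power_deriv_Suc:
  "power_deriv n (Suc j) x = (if n = 0 then 0 else of_nat n * power_deriv (n - 1) j x)"
  by (cases n) (auto simp: power_deriv_def)

lemma has_field_derivative_power_deriv:
  "(power_deriv n j has_field_derivative power_deriv n (Suc j) x) (at x)"
proof (cases "j < n")
  case True
  then have eq: "n - j = Suc (n - Suc j)" by simp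
  have "((\<lambda>x. fact n / fact (n - j) * x ^ (n - j)) has_field_derivative
      fact n / fact (n - j) * (of_nat (n - j) * x ^ (n - Suc j))) (at x)"
    by (auto intro!: derivative_eq_intros)
  moreover have "fact n / fact (n - j) * (of_nat (n - j) * x ^ (n - Suc j)) = power_deriv n (Suc j) x"
    using True of_nat_neq_0[of "n - Suc j", where 'a='a]
    by (simp add: power_deriv_def eq del: of_nat_Suc)
  moreover have "power_deriv n j = (\<lambda>x::'a. fact n / fact (n - j) * x ^ (n - j))"
    using True by (auto simp: power_deriv_def)
  ultimately show ?thesis by (simp only:)
next
  case False
  \<comment> \<open>At \<open>j = n\<close> the function is the constant \<open>fact n\<close>. Its
    derivative 0 agrees with the zero branch of \<open>power_deriv\<close> at \<open>Suc n\<close>,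
    where truncated subtraction alone would give \<open>fact n\<close> again.\<close>
  then have "power_deriv n j = (\<lambda>x::'a. if j = n then fact n else 0)"
    by (auto simp: power_deriv_def)
  with False show ?thesis by (simp add: power_deriv_eq_0)
qed

lemma has_field_derivative_sum_power_deriv:
  "((\<lambda>x. \<Sum>k\<in>A. a k * power_deriv n (s k) x) has_field_derivative
     (\<Sum>k\<in>A. a k * power_deriv n (Suc (s k)) x)) (at x)"
  by (intro DERIV_sum DERIV_cmult has_field_derivative_power_deriv)

lemma higher_deriv_sum_power_deriv:
  "(deriv ^^ j) (\<lambda>x. \<Sum>k\<in>A. a k * power_deriv n (s k) x) =
     (\<lambda>x. \<Sum>k\<in>A. a k * power_deriv n (s k + j) x)"
  by (induction j) (simp_all add: DERIV_imp_deriv[OF has_field_derivative_sum_power_deriv])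

lemma gen_hermite_eq_infsum:
  "gen_hermite p q n m z w \<gamma> =
     (\<Sum>\<^sub>\<infinity>k. \<gamma> ^ k / fact k * power_deriv n (p * k) z * power_deriv m (q * k) w)"
proof -
  \<comment> \<open>For \<open>p = 0\<close> both sides hold for every \<open>k\<close>, so the
    product form absorbs the convention for division by zero.\<close>
  have "enat k \<le> efloor_div n p \<longleftrightarrow> p * k \<le> n" for k n p
    by (simp add: efloor_div_def less_eq_div_iff_mult_less_eq mult.commute)
  then have idx: "{k. enat k \<le> min (efloor_div n p) (efloor_div m q)} = {k. p * k \<le> n \<and> q * k \<le> m}"
    by auto
  show ?thesis
    unfolding gen_hermite_def idx infsum_cmult_right'[symmetric]
    by (rule infsum_cong_neutral) (auto simp: power_deriv_def)
qed

text \<open>Here no term vanishes for large \<open>k\<close>, so truncation is impossible; the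
  factors in \<open>z\<close> and \<open>w\<close> do not depend on \<open>k\<close> and come out of
  the exponential series.\<close>

lemma gen_hermite_0_0: "gen_hermite 0 0 n m z w \<gamma> = exp \<gamma> * z ^ n * w ^ m"
proof -
  \<comment> \<open>Absolute convergence turns the ordered series into an unordered sum.\<close>
  have "((\<lambda>k. \<gamma> ^ k /\<^sub>R fact k) has_sum exp \<gamma>) UNIV"
    using summable_norm_exp[of \<gamma>] exp_converges[of \<gamma>]
    by (intro norm_summable_imp_has_sum) auto
  then have "(\<Sum>\<^sub>\<infinity>k. \<gamma> ^ k / fact k) = exp \<gamma>"
    by (intro infsumI) (simp add: scaleR_conv_of_real field_simps)
  then show ?thesis
    by (simp add: gen_hermite_eq_infsum infsum_cmult_left' del: times_divide_eq_left)
qed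

text \<open>A positive \<open>p\<close> gives \<open>p * k \<ge> k > n\<close>, a positive
  \<open>q\<close> gives \<open>q * k \<ge> k > m\<close>. The bound \<open>n + m\<close> covers
  both cases at once.\<close>

lemma power_deriv_mult_eq_0:
  assumes "p \<noteq> 0 \<or> q \<noteq> 0" and "n + m < k"
  shows "power_deriv n (p * k) z * power_deriv m (q * k) w = 0"
proof -
  have "n < p * k \<or> m < q * k"
    using assms by (cases p; cases q) auto
  then show ?thesis by (auto simp: power_deriv_eq_0)
qed

text \<open>The cutoff \<open>N\<close> is left free so that one value serves the lowered indices as
  well.\<close>

lemma gen_hermite_eq_sum:
  assumes "p \<noteq> 0 \<or> q \<noteq> 0" and "n + m \<le> N"
  shows "gen_hermite p q n m z w \<gamma> =
     (\<Sum>k\<le>N. \<gamma> ^ k / fact k * power_deriv n (p * k) z * power_deriv m (q * k) w)"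
proof -
  have "gen_hermite p q n m z w \<gamma> =
     (\<Sum>\<^sub>\<infinity>k\<in>{..N}. \<gamma> ^ k / fact k * power_deriv n (p * k) z * power_deriv m (q * k) w)"
    unfolding gen_hermite_eq_infsum
  proof (rule infsum_cong_neutral)
    show "\<gamma> ^ k / fact k * power_deriv n (p * k) z * power_deriv m (q * k) w = 0"
      if "k \<in> UNIV - {..N}" for k
      using that assms(2) power_deriv_mult_eq_0[OF assms(1), of n m k z w]
      by (simp add: mult.assoc del: mult_eq_0_iff)
  qed auto
  then show ?thesis by simp
qed

text \<open>Treats the exponential series \<open>p = q = 0\<close> (one term with \<open>c\<^sub>0 = exp\<close>) and the finite sums
  (with \<open>c\<^sub>k(\<gamma>) = \<gamma>\<^sup>k / k!\<close>) alike.\<close>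

lemma gen_hermite_finite_expansion:
  fixes n m p q :: nat
  obtains N :: nat and c :: "nat \<Rightarrow> complex \<Rightarrow> complex" where
    "\<And>n' m' z w \<gamma>. n' \<le> n \<Longrightarrow> m' \<le> m \<Longrightarrow> gen_hermite p q n' m' z w \<gamma> =
       (\<Sum>k\<le>N. c k \<gamma> * power_deriv n' (p * k) z * power_deriv m' (q * k) w)"
    "\<And>z w \<gamma>. ((\<lambda>\<gamma>. \<Sum>k\<le>N. c k \<gamma> * power_deriv n (p * k) z * power_deriv m (q * k) w)
       has_field_derivative
         (\<Sum>k\<le>N. c k \<gamma> * power_deriv n (p * k + p) z * power_deriv m (q * k + q) w)) (at \<gamma>)"
proof (cases "p = 0 \<and> q = 0")
  case True
  show ?thesis
  proof (rule that[where N = 0 and c = "\<lambda>_. exp"])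
    show "((\<lambda>\<gamma>. \<Sum>k\<le>0. exp \<gamma> * power_deriv n (p * k) z * power_deriv m (q * k) w)
       has_field_derivative
         (\<Sum>k\<le>0. exp \<gamma> * power_deriv n (p * k + p) z * power_deriv m (q * k + q) w)) (at \<gamma>)"
      for z w \<gamma> :: complex
      using True by (auto intro!: derivative_eq_intros)
  qed (use True in \<open>simp add: gen_hermite_0_0\<close>)
next
  case False
  define N where "N = n + m"
  show ?thesis
  proof (rule that[where N = N and c = "\<lambda>k \<gamma>. \<gamma> ^ k / fact k"])
    fix z w \<gamma> :: complex
    define f where "f k = power_deriv n (p * k) z * power_deriv m (q * k) w" for k
    have f_last: "f (Suc N) = 0"
      unfolding f_def by (rule power_deriv_mult_eq_0) (use False in \<open>auto simp: N_def\<close>)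
    \<comment> \<open>The vanishing term at \<open>Suc N\<close> is added because differentiation
      kills \<open>k = 0\<close> and shifts the rest down by one, leaving exactly the range
      \<open>k \<le> N\<close>.\<close>
    have "((\<lambda>\<gamma>. \<Sum>k\<le>Suc N. \<gamma> ^ k / fact k * f k) has_field_derivative
        (\<Sum>k\<le>Suc N. of_nat k * \<gamma> ^ (k - 1) / fact k * f k)) (at \<gamma>)"
      by (rule DERIV_sum) (auto intro!: derivative_eq_intros)
    also have "(\<Sum>k\<le>Suc N. of_nat k * \<gamma> ^ (k - 1) / fact k * f k) =
        (\<Sum>k\<le>N. \<gamma> ^ k / fact k * f (Suc k))"
      by (subst sum.atMost_Suc_shift) (auto intro!: sum.cong simp del: of_nat_Suc)
    finally show "((\<lambda>\<gamma>. \<Sum>k\<le>N. \<gamma> ^ k / fact k * power_deriv n (p * k) z * power_deriv m (q * k) w)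
       has_field_derivative
         (\<Sum>k\<le>N. \<gamma> ^ k / fact k * power_deriv n (p * k + p) z * power_deriv m (q * k + q) w)) (at \<gamma>)"
      by (simp add: f_last) (simp add: f_def mult.assoc add.commute)
  qed (rule gen_hermite_eq_sum, use False in \<open>auto simp: N_def\<close>)
qed

theorem proposition6p1:
  fixes n m p q :: nat and z w \<gamma> :: complex
  shows "((\<lambda>z. gen_hermite p q n m z w \<gamma>) has_field_derivative
            (if n = 0 then 0 else of_nat n * gen_hermite p q (n - 1) m z w \<gamma>)) (at z)
       \<and> ((\<lambda>w. gen_hermite p q n m z w \<gamma>) has_field_derivative
            (if m = 0 then 0 else of_nat m * gen_hermite p q n (m - 1) z w \<gamma>)) (at w)
       \<and> ((\<lambda>\<gamma>. gen_hermite p q n m z w \<gamma>) has_field_derivative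
            (deriv ^^ p) (\<lambda>z. (deriv ^^ q) (\<lambda>w. gen_hermite p q n m z w \<gamma>) w) z) (at \<gamma>)"
proof -
  obtain N c where expand:
      "\<And>n' m' z w \<gamma>. n' \<le> n \<Longrightarrow> m' \<le> m \<Longrightarrow> gen_hermite p q n' m' z w \<gamma> =
         (\<Sum>k\<le>N. c k \<gamma> * power_deriv n' (p * k) z * power_deriv m' (q * k) w)"
    and deriv_param:
      "\<And>z w \<gamma>. ((\<lambda>\<gamma>. \<Sum>k\<le>N. c k \<gamma> * power_deriv n (p * k) z * power_deriv m (q * k) w)
         has_field_derivative
           (\<Sum>k\<le>N. c k \<gamma> * power_deriv n (p * k + p) z * power_deriv m (q * k + q) w)) (at \<gamma>)"
    by (rule gen_hermite_finite_expansion[of n m p q]) blast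
  \<comment> \<open>The factor in \<open>z\<close> is moved to the end, so that the rest is a
    coefficient constant in \<open>z\<close>.\<close>
  have expand_z: "gen_hermite p q n' m z w \<gamma> =
      (\<Sum>k\<le>N. (c k \<gamma> * power_deriv m (q * k) w) * power_deriv n' (p * k) z)"
    if "n' \<le> n" for n' z
    using that by (simp add: expand mult_ac)
  have lower_z: "(\<Sum>k\<le>N. (c k \<gamma> * power_deriv m (q * k) w) * power_deriv n (Suc (p * k)) z) =
      (if n = 0 then 0 else of_nat n * gen_hermite p q (n - 1) m z w \<gamma>)"
    by (simp add: power_deriv_Suc expand_z sum_distrib_left mult_ac)
  have lower_w: "(\<Sum>k\<le>N. (c k \<gamma> * power_deriv n (p * k) z) * power_deriv m (Suc (q * k)) w) =
      (if m = 0 then 0 else of_nat m * gen_hermite p q n (m - 1) z w \<gamma>)"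
    by (simp add: power_deriv_Suc expand sum_distrib_left mult_ac)
  \<comment> \<open>The inner derivatives raise the second index of the \<open>w\<close> factor by
    \<open>q\<close>; regrouping then prepares the same rule for the \<open>p\<close> derivatives in
    \<open>z\<close>.\<close>
  have "(\<lambda>z. (deriv ^^ q) (\<lambda>w. gen_hermite p q n m z w \<gamma>) w) =
      (\<lambda>z. \<Sum>k\<le>N. (c k \<gamma> * power_deriv m (q * k + q) w) * power_deriv n (p * k) z)"
    by (simp add: expand higher_deriv_sum_power_deriv) (simp add: mult_ac)
  then have mixed: "(deriv ^^ p) (\<lambda>z. (deriv ^^ q) (\<lambda>w. gen_hermite p q n m z w \<gamma>) w) z =
      (\<Sum>k\<le>N. c k \<gamma> * power_deriv n (p * k + p) z * power_deriv m (q * k + q) w)"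
    by (simp only: higher_deriv_sum_power_deriv) (simp add: mult_ac)
  show ?thesis
    unfolding mixed lower_z[symmetric] lower_w[symmetric]
  proof (intro conjI)
    show "((\<lambda>z. gen_hermite p q n m z w \<gamma>) has_field_derivative
        (\<Sum>k\<le>N. (c k \<gamma> * power_deriv m (q * k) w) * power_deriv n (Suc (p * k)) z)) (at z)"
      unfolding expand_z[OF order_refl] by (rule has_field_derivative_sum_power_deriv)
    show "((\<lambda>w. gen_hermite p q n m z w \<gamma>) has_field_derivative
        (\<Sum>k\<le>N. (c k \<gamma> * power_deriv n (p * k) z) * power_deriv m (Suc (q * k)) w)) (at w)"
      unfolding expand[OF order_refl order_refl] by (rule has_field_derivative_sum_power_deriv)
  qed (simp add: expand deriv_param)
qed

end
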